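(* On the $\mathfrak{sl}_4(\mathbb C)$-module $P=\mathbb C[x,y,z,w]$, $$\frac{(\Omega+2I)^2}2-L_1R_1-R_1L_1=\frac{4A_2^2+4A_3^{*2}-(A_2A_3^*-A_3^*A_2)^2}8=\frac{4A_2^{*2}+4A_3^2-(A_2^*A_3-A_3A_2^* )^2}8 .$$ Call this common value $C_1$. Then $C_1$ commutes with each of $$\Omega,\quad L_1,\quad R_1,\quad A_2,\quad A_2^*,\quad A_3,\quad A_3^*,\quad\sigma .$$
   Context: With $E_{a,b}$ the $4\times4$ matrix units, define in $\mathfrak{sl}_4(\mathbb C)$: $A_2=E_{13}+E_{31}+E_{24}+E_{42}$, $A_3=E_{14}+E_{41}+E_{23}+E_{32}$, $A_2^*={\rm diag}(1,-1,1,-1)$, $A_3^*={\rm diag}(1,-1,-1,1)$. $P=\mathbb C[x,y,z,w]$ is an $\mathfrak{sl}_4(\mathbb C)$-module on which every element acts as a derivation, and on the degree-one part $\varphi\in\mathfrak{sl}_4(\mathbb C)$ acts by its matrix with respect to the ordered basis $(v_1,v_2,v_3,v_4)=(x,y,z,w)$, i.e. $\varphi v_b=\sum_a\varphi_{ab}v_a$. Products of the $A_i,A_i^*$ are compositions in ${\rm End}(P)$, and $I$ is the identity. $\Omega\in{\rm End}(P)$ acts on the homogeneous polynomials of total degree $N$ as $N$ times the identity, for each $N\in\mathbb N=\{0,1,2,\ldots\}$. $L_1=\frac{\partial^2}{\partial x\partial y}-\frac{\partial^2}{\partial z\partial w}$ and $R_1(f)=(xy-zw)f$. $\sigma$ is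 the algebra automorphism of $P$ that sends $x\mapsto\frac{x+y+z+w}2$, $y\mapsto\frac{x+y-z-w}2$, $z\mapsto\frac{x-y+z-w}2$, $w\mapsto\frac{x-y-z+w}2$. *)

theory Defs
  imports
    "HOL-Analysis.Analysis"
    "HOL-Library.Poly_Mapping"
    "HOL-Library.Function_Algebras"
begin

section \<open>The polynomial algebra $P$\<close>

text \<open>
  The four variables are indexed by the numeral type \<open>4\<close>, which is also the index type of the
  $4 \times 4$ matrices below, in the order $1, 2, 3, 4$ (in this type \<open>4 = 0\<close>, which is harmless).
  A monomial is its exponent function \<open>4 \<Rightarrow>\<^sub>0 nat\<close>; multiplication of
  \<open>poly_mapping\<close>s is convolution, so \<open>poly4\<close> is $\mathbb{C}[x,y,z,w]$.
\<close>

type_synonym poly4 = "(4 \<Rightarrow>\<^sub>0 nat) \<Rightarrow>\<^sub>0 complex"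

definition pvar :: "4 \<Rightarrow> poly4" where
  "pvar i = Poly_Mapping.single (Poly_Mapping.single i 1) 1"

abbreviation "px \<equiv> pvar 1"
abbreviation "py \<equiv> pvar 2"
abbreviation "pz \<equiv> pvar 3"
abbreviation "pw \<equiv> pvar 4"

definition pscale :: "complex \<Rightarrow> poly4 \<Rightarrow> poly4" where
  "pscale c f = Poly_Mapping.single 0 c * f"

global_interpretation poly4: vector_space pscale
  by standard
    (simp_all add: pscale_def distrib_left single_add distrib_right mult_single flip: mult.assoc)

definition op_scale :: "complex \<Rightarrow> (poly4 \<Rightarrow> poly4) \<Rightarrow> (poly4 \<Rightarrow> poly4)" (infixr \<open>*\<^sub>o\<close> 75) where
  "c *\<^sub>o T = (\<lambda>f. pscale c (T f))"

abbreviation P_linear :: "(poly4 \<Rightarrow> poly4) \<Rightarrow> bool" where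
  "P_linear \<equiv> Vector_Spaces.linear pscale pscale"

text \<open>The linear map $P \to P$ with prescribed values on the monomials.\<close>

definition lin_ext :: "((4 \<Rightarrow>\<^sub>0 nat) \<Rightarrow> poly4) \<Rightarrow> poly4 \<Rightarrow> poly4" where
  "lin_ext g f = (\<Sum>m\<in>Poly_Mapping.keys f. pscale (Poly_Mapping.lookup f m) (g m))"

definition tdeg :: "(4 \<Rightarrow>\<^sub>0 nat) \<Rightarrow> nat" where
  "tdeg m = (\<Sum>i\<in>UNIV. Poly_Mapping.lookup m i)"

definition homogeneous :: "nat \<Rightarrow> poly4 \<Rightarrow> bool" where
  "homogeneous N f \<longleftrightarrow> (\<forall>m\<in>Poly_Mapping.keys f. tdeg m = N)"

definition pderiv4 :: "4 \<Rightarrow> poly4 \<Rightarrow> poly4" where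
  "pderiv4 b = lin_ext (\<lambda>m. Poly_Mapping.single (m - Poly_Mapping.single b 1)
                                (of_nat (Poly_Mapping.lookup m b)))"

definition psubst :: "(4 \<Rightarrow> poly4) \<Rightarrow> poly4 \<Rightarrow> poly4" where
  "psubst s = lin_ext (\<lambda>m. \<Prod>i\<in>UNIV. s i ^ Poly_Mapping.lookup m i)"


section \<open>The operators\<close>

definition derivation :: "(poly4 \<Rightarrow> poly4) \<Rightarrow> bool" where
  "derivation D \<longleftrightarrow> P_linear D \<and> (\<forall>f g. D (f * g) = D f * g + f * D g)"

text \<open>
  The action of a matrix. It is given by its formula as a first-order differential operator;
  \<open>act_unique\<close> below shows that \<open>act \<phi>\<close> is the unique derivation acting on degree one by the
  matrix \<open>\<phi>\<close>, and \<open>act_bracket\<close> that this is a Lie algebra action. It is defined on all of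
  $\mathfrak{gl}_4$; the matrices used lie in $\mathfrak{sl}_4$.
\<close>

definition act :: "complex^4^4 \<Rightarrow> poly4 \<Rightarrow> poly4" where
  "act \<phi> f = (\<Sum>a\<in>UNIV. \<Sum>b\<in>UNIV. pscale (\<phi> $ a $ b) (pvar a * pderiv4 b f))"

definition sl4 :: "(complex^4^4) set" where
  "sl4 = {\<phi>. trace \<phi> = 0}"

definition mat_unit :: "4 \<Rightarrow> 4 \<Rightarrow> complex^4^4" where
  "mat_unit a b = (\<chi> i j. if i = a \<and> j = b then 1 else 0)"

definition diag4 :: "complex \<Rightarrow> complex \<Rightarrow> complex \<Rightarrow> complex \<Rightarrow> complex^4^4" where
  "diag4 c1 c2 c3 c4 = (\<chi> i j. if i \<noteq> j then 0
     else if i = 1 then c1 else if i = 2 then c2 else if i = 3 then c3 else c4)"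

definition A2 :: "complex^4^4" where "A2 = mat_unit 1 3 + mat_unit 3 1 + mat_unit 2 4 + mat_unit 4 2"
definition A3 :: "complex^4^4" where "A3 = mat_unit 1 4 + mat_unit 4 1 + mat_unit 2 3 + mat_unit 3 2"
definition A2s :: "complex^4^4" where "A2s = diag4 1 (-1) 1 (-1)"
definition A3s :: "complex^4^4" where "A3s = diag4 1 (-1) (-1) 1"

definition Omega :: "poly4 \<Rightarrow> poly4" where
  "Omega = lin_ext (\<lambda>m. Poly_Mapping.single m (of_nat (tdeg m)))"

definition L1 :: "poly4 \<Rightarrow> poly4" where
  "L1 f = pderiv4 1 (pderiv4 2 f) - pderiv4 3 (pderiv4 4 f)"

definition R1 :: "poly4 \<Rightarrow> poly4" where
  "R1 f = (px * py - pz * pw) * f"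

definition sigma_img :: "4 \<Rightarrow> poly4" where
  "sigma_img i = pscale (1/2)
     (if i = 1 then px + py + pz + pw
      else if i = 2 then px + py - pz - pw
      else if i = 3 then px - py + pz - pw
      else px - py - pz + pw)"

definition sigma_aut :: "poly4 \<Rightarrow> poly4" where
  "sigma_aut = psubst sigma_img"


section \<open>The definitions have the properties that characterise the operators\<close>

lemma poly4_expand: "f = (\<Sum>m\<in>Poly_Mapping.keys f. Poly_Mapping.single m (Poly_Mapping.lookup f m))"
  by (rule poly_mapping_eqI) (simp add: lookup_sum lookup_single when_def in_keys_iff)

lemma pscale_single: "pscale c (Poly_Mapping.single m d) = Poly_Mapping.single m (c * d)"
  by (simp add: pscale_def mult_single)

lemma P_linearI:
  assumes "\<And>f g. T (f + g) = T f + T g" and "\<And>c f. T (pscale c f) = pscale c (T f)"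
  shows "P_linear T"
  by (intro Vector_Spaces.linear_iff[THEN iffD2] conjI allI assms poly4.vector_space_axioms)

lemma P_linear_add: "P_linear T \<Longrightarrow> T (f + g) = T f + T g"
  and P_linear_scale: "P_linear T \<Longrightarrow> T (pscale c f) = pscale c (T f)"
  by (simp_all add: Vector_Spaces.linear_iff)

lemma lookup_pscale: "Poly_Mapping.lookup (pscale c f) m = c * Poly_Mapping.lookup f m"
proof -
  have "Poly_Mapping.map ((*) c) f = pscale c f"
    unfolding pscale_def by (rule mult_map_scale_conv_mult)
  then have "Poly_Mapping.lookup (pscale c f) m = Poly_Mapping.lookup (Poly_Mapping.map ((*) c) f) m"
    by simp
  also have "\<dots> = c * Poly_Mapping.lookup f m"
    by (simp add: Poly_Mapping.map.rep_eq when_def)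
  finally show ?thesis .
qed

lemma lin_ext_superset:
  assumes "finite S" "Poly_Mapping.keys f \<subseteq> S"
  shows "lin_ext g f = (\<Sum>m\<in>S. pscale (Poly_Mapping.lookup f m) (g m))"
  unfolding lin_ext_def
  by (rule sum.mono_neutral_left) (use assms in \<open>auto simp: in_keys_iff\<close>)

lemma P_linear_lin_ext: "P_linear (lin_ext g)"
proof (rule P_linearI)
  fix f h :: poly4 and c
  let ?S = "Poly_Mapping.keys f \<union> Poly_Mapping.keys h"
  have "lin_ext g (f + h) = (\<Sum>m\<in>?S. pscale (Poly_Mapping.lookup (f + h) m) (g m))"
    by (rule lin_ext_superset) (use keys_add[of f h] in auto)
  also have "\<dots> = lin_ext g f + lin_ext g h"
    by (simp add: lookup_add poly4.scale_left_distrib sum.distrib lin_ext_superset[of ?S])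
  finally show "lin_ext g (f + h) = lin_ext g f + lin_ext g h" .
  have "lin_ext g (pscale c f) =
      (\<Sum>m\<in>Poly_Mapping.keys f. pscale (Poly_Mapping.lookup (pscale c f) m) (g m))"
    by (rule lin_ext_superset) (auto simp: in_keys_iff lookup_pscale)
  also have "\<dots> = pscale c (lin_ext g f)"
    by (simp add: lookup_pscale lin_ext_def poly4.scale_sum_right)
  finally show "lin_ext g (pscale c f) = pscale c (lin_ext g f)" .
qed

lemma lin_ext_single: "lin_ext g (Poly_Mapping.single m c) = pscale c (g m)"
  by (simp add: lin_ext_def)

lemma P_linear_eqI:
  assumes T: "P_linear T" and U: "P_linear U"
    and eq: "\<And>m. T (Poly_Mapping.single m 1) = U (Poly_Mapping.single m 1)"
  shows "T f = U f"
proof -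
  have exp: "V f = (\<Sum>m\<in>Poly_Mapping.keys f.
      pscale (Poly_Mapping.lookup f m) (V (Poly_Mapping.single m 1)))" if "P_linear V" for V
  proof -
    have "f = (\<Sum>m\<in>Poly_Mapping.keys f.
        pscale (Poly_Mapping.lookup f m) (Poly_Mapping.single m 1))"
      using poly4_expand[of f] by (simp add: pscale_single)
    then have "V f = V (\<Sum>m\<in>Poly_Mapping.keys f.
        pscale (Poly_Mapping.lookup f m) (Poly_Mapping.single m 1))" by simp
    also have "\<dots> = (\<Sum>m\<in>Poly_Mapping.keys f.
        V (pscale (Poly_Mapping.lookup f m) (Poly_Mapping.single m 1)))"
      by (rule module_hom.sum) (use that in \<open>simp add: linear_iff_module_hom\<close>)
    finally show ?thesis by (simp add: P_linear_scale[OF that])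
  qed
  show ?thesis using exp[OF T] exp[OF U] by (simp add: eq)
qed

lemma monom_induct [case_names one var]:
  assumes "Q (0 :: 4 \<Rightarrow>\<^sub>0 nat)" and step: "\<And>b m. Q m \<Longrightarrow> Q (Poly_Mapping.single b 1 + m)"
  shows "Q m"
proof (induction "tdeg m" arbitrary: m rule: less_induct)
  case less
  show ?case
  proof (cases "m = 0")
    case True
    then show ?thesis using assms by simp
  next
    case False
    then obtain b where b: "Poly_Mapping.lookup m b \<noteq> 0"
      by (metis lookup_zero poly_mapping_eqI)
    define m' where "m' = m - Poly_Mapping.single b 1"
    have m: "m = Poly_Mapping.single b 1 + m'"
      by (rule poly_mapping_eqI)
        (use b in \<open>auto simp: m'_def lookup_add lookup_minus lookup_single when_def\<close>)
    have "tdeg m = Suc (tdeg m')"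
      by (subst m) (simp add: tdeg_def lookup_add sum.distrib lookup_single when_def)
    then show ?thesis using less step m by (metis lessI)
  qed
qed

lemma poly4_induct [case_names const add var]:
  assumes "\<And>c. Q (Poly_Mapping.single 0 c)" "\<And>f g. Q f \<Longrightarrow> Q g \<Longrightarrow> Q (f + g)"
    "\<And>b f. Q f \<Longrightarrow> Q (pvar b * f)"
  shows "Q f"
proof -
  have single: "Q (Poly_Mapping.single m c)" for m c
  proof (induction m rule: monom_induct)
    case one then show ?case by (rule assms)
  next
    case (var b m)
    then show ?case using assms(3)[of "Poly_Mapping.single m c" b] by (simp add: pvar_def mult_single)
  qed
  have "Q (\<Sum>m\<in>S. Poly_Mapping.single m (Poly_Mapping.lookup f m))" if "finite S" for S
    using that
  proof induction
    case empty then show ?case using assms(1)[of 0] by simp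
  next
    case (insert m S) then show ?case using single assms(2) by simp
  qed
  then show ?thesis using poly4_expand[of f] by (metis finite_keys)
qed

lemma pscale_mult_left: "pscale c f * g = pscale c (f * g)"
  and pscale_mult_right: "f * pscale c g = pscale c (f * g)"
  by (simp_all add: pscale_def mult_ac)

lemma P_linear_0: "P_linear (\<lambda>f. 0)"
  and P_linear_id: "P_linear (\<lambda>f. f)"
  and P_linear_plus: "P_linear T \<Longrightarrow> P_linear U \<Longrightarrow> P_linear (\<lambda>f. T f + U f)"
  and P_linear_minus: "P_linear T \<Longrightarrow> P_linear U \<Longrightarrow> P_linear (\<lambda>f. T f - U f)"
  and P_linear_cmul: "P_linear T \<Longrightarrow> P_linear (\<lambda>f. pscale c (T f))"
  and P_linear_mult: "P_linear T \<Longrightarrow> P_linear (\<lambda>f. h * T f)"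
  and P_linear_comp: "P_linear T \<Longrightarrow> P_linear U \<Longrightarrow> P_linear (\<lambda>f. T (U f))"
  by (auto intro!: P_linearI simp: P_linear_add P_linear_scale algebra_simps
      poly4.scale_right_distrib poly4.scale_right_diff_distrib pscale_mult_right mult.commute[of c])

lemma P_linear_sum: "(\<And>i. i \<in> S \<Longrightarrow> P_linear (T i)) \<Longrightarrow> P_linear (\<lambda>f. \<Sum>i\<in>S. T i f)"
  by (induction S rule: infinite_finite_induct) (auto intro: P_linear_0 P_linear_plus)

lemma P_linear_pderiv4: "P_linear (pderiv4 b)"
  and P_linear_psubst: "P_linear (psubst s)"
  and P_linear_Omega: "P_linear Omega"
  unfolding pderiv4_def psubst_def Omega_def by (rule P_linear_lin_ext)+

lemma P_linear_act: "P_linear (act \<phi>)"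
  unfolding act_def[abs_def]
  by (intro P_linear_sum P_linear_cmul P_linear_mult P_linear_pderiv4)

lemma pderiv4_single: "pderiv4 b (Poly_Mapping.single m c) =
    Poly_Mapping.single (m - Poly_Mapping.single b 1) (c * of_nat (Poly_Mapping.lookup m b))"
  by (simp add: pderiv4_def lin_ext_single pscale_single)

lemma pderiv4_pvar_mult:
  "pderiv4 b (pvar a * f) = (if a = b then f else 0) + pvar a * pderiv4 b f"
proof (rule P_linear_eqI[of "\<lambda>f. pderiv4 b (pvar a * f)"
      "\<lambda>f. (if a = b then f else 0) + pvar a * pderiv4 b f"])
  show "P_linear (\<lambda>f. pderiv4 b (pvar a * f))"
    by (intro P_linear_comp[OF P_linear_pderiv4] P_linear_mult P_linear_id)
  show "P_linear (\<lambda>f. (if a = b then f else 0) + pvar a * pderiv4 b f)"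
    by (cases "a = b") (auto intro!: P_linear_plus P_linear_mult P_linear_id P_linear_0 P_linear_pderiv4)
next
  fix m :: "4 \<Rightarrow>\<^sub>0 nat"
  let ?e = "\<lambda>i. Poly_Mapping.single i (1::nat)"
  have shift: "?e a + m - ?e b = ?e a + (m - ?e b)" if "Poly_Mapping.lookup m b \<noteq> 0"
    by (rule poly_mapping_eqI)
      (use that in \<open>auto simp: lookup_add lookup_minus lookup_single when_def\<close>)
  have same: "?e b + (m - ?e b) = m" if "Poly_Mapping.lookup m b \<noteq> 0"
    by (rule poly_mapping_eqI)
      (use that in \<open>auto simp: lookup_add lookup_minus lookup_single when_def\<close>)
  show "pderiv4 b (pvar a * Poly_Mapping.single m 1) =
    (if a = b then Poly_Mapping.single m 1 else 0) + pvar a * pderiv4 b (Poly_Mapping.single m 1)"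
  proof (cases "a = b")
    case True
    show ?thesis
    proof (cases "Poly_Mapping.lookup m b = 0")
      case True
      then show ?thesis using \<open>a = b\<close> by (simp add: pvar_def mult_single pderiv4_single lookup_add)
    next
      case False
      have "Poly_Mapping.single m (1 + of_nat (Poly_Mapping.lookup m b) :: complex) =
          Poly_Mapping.single m 1 + Poly_Mapping.single m (of_nat (Poly_Mapping.lookup m b))"
        by (rule single_add)
      then show ?thesis using \<open>a = b\<close> same[OF False] by (simp add: pvar_def mult_single pderiv4_single lookup_add)
    qed
  next
    case False
    then have "Poly_Mapping.lookup (?e a + m) b = Poly_Mapping.lookup m b"
      by (simp add: lookup_add lookup_single)
    then show ?thesis using shift False
      by (cases "Poly_Mapping.lookup m b = 0") (simp_all add: pvar_def mult_single pderiv4_single)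
  qed
qed

lemma pderiv4_const: "pderiv4 b (Poly_Mapping.single 0 c) = 0"
  by (simp add: pderiv4_single)

lemma pderiv4_pvar: "pderiv4 b (pvar a) = (if a = b then 1 else 0)"
  using pderiv4_pvar_mult[of b a 1] pderiv4_const[of b 1] by simp

lemma derivation_pderiv4: "derivation (pderiv4 b)"
  unfolding derivation_def
proof (intro conjI allI P_linear_pderiv4)
  fix f g
  show "pderiv4 b (f * g) = pderiv4 b f * g + f * pderiv4 b g"
  proof (induction f rule: poly4_induct)
    case (const c)
    have "pderiv4 b (pscale c g) = pscale c (pderiv4 b g)"
      by (rule P_linear_scale[OF P_linear_pderiv4])
    then show ?case by (simp add: pderiv4_const pscale_def)
  next
    case (add f h)
    then show ?case by (simp add: P_linear_add[OF P_linear_pderiv4] algebra_simps)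
  next
    case (var a f)
    have "pderiv4 b (pvar a * f * g) = (if a = b then f * g else 0) + pvar a * pderiv4 b (f * g)"
      unfolding mult.assoc by (rule pderiv4_pvar_mult)
    then show ?case by (simp only: pderiv4_pvar_mult var) (simp add: algebra_simps)
  qed
qed

lemma derivation_act: "derivation (act \<phi>)"
  unfolding derivation_def
proof (intro conjI allI P_linear_act)
  fix f g
  have "pderiv4 b (f * g) = pderiv4 b f * g + f * pderiv4 b g" for b
    using derivation_pderiv4 unfolding derivation_def by blast
  then have "pscale (\<phi> $ a $ b) (pvar a * pderiv4 b (f * g)) =
      pscale (\<phi> $ a $ b) (pvar a * pderiv4 b f) * g + f * pscale (\<phi> $ a $ b) (pvar a * pderiv4 b g)"
    for a b
    by (simp add: distrib_left poly4.scale_right_distrib pscale_mult_left pscale_mult_right)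
      (simp add: mult_ac)
  then show "act \<phi> (f * g) = act \<phi> f * g + f * act \<phi> g"
    by (simp only: act_def sum.distrib sum_distrib_left sum_distrib_right)
qed

lemma act_pvar: "act \<phi> (pvar b) = (\<Sum>a\<in>UNIV. pscale (\<phi> $ a $ b) (pvar a))"
proof -
  have "pscale (\<phi> $ a $ c) (pvar a * pderiv4 c (pvar b)) =
      (if c = b then pscale (\<phi> $ a $ b) (pvar a) else 0)" for a c
    by (simp add: pderiv4_pvar)
  then show ?thesis by (simp add: act_def)
qed

lemma derivation_eqI:
  assumes D: "derivation D" and D': "derivation D'" and eq: "\<And>b. D (pvar b) = D' (pvar b)"
  shows "D = D'"
proof
  fix f
  have D_const: "U (Poly_Mapping.single 0 c) = 0" if "derivation U" for U c
  proof -
    have "U (1 * 1) = U 1 * 1 + 1 * U 1" using that unfolding derivation_def by blast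
    then have "U 1 = 0" by simp
    moreover have "Poly_Mapping.single 0 c = pscale c 1" by (simp add: pscale_def)
    ultimately show ?thesis using that by (simp add: derivation_def P_linear_scale)
  qed
  show "D f = D' f"
  proof (induction f rule: poly4_induct)
    case (const c) then show ?case using D_const[OF D] D_const[OF D'] by simp
  next
    case (add f g) then show ?case using D D' by (simp add: derivation_def P_linear_add)
  next
    case (var b f) then show ?case using D D' eq by (simp add: derivation_def)
  qed
qed

theorem act_unique:
  "D = act \<phi> \<longleftrightarrow>
     derivation D \<and> (\<forall>b. D (pvar b) = (\<Sum>a\<in>UNIV. pscale (\<phi> $ a $ b) (pvar a)))"
  by (auto simp: derivation_act act_pvar intro: derivation_eqI[OF _ derivation_act])

theorem act_bracket:
  "act (\<phi> ** \<psi> - \<psi> ** \<phi>) = (act \<phi> \<circ> act \<psi>) - (act \<psi> \<circ> act \<phi>)"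
proof (rule derivation_eqI[OF derivation_act, where D' = "(act \<phi> \<circ> act \<psi>) - (act \<psi> \<circ> act \<phi>)"])
  show "derivation ((act \<phi> \<circ> act \<psi>) - (act \<psi> \<circ> act \<phi>))"
    unfolding derivation_def
  proof (intro conjI allI)
    have "P_linear (\<lambda>f. act \<phi> (act \<psi> f) - act \<psi> (act \<phi> f))"
      by (rule P_linear_minus[OF P_linear_comp[OF P_linear_act P_linear_act]
            P_linear_comp[OF P_linear_act P_linear_act]])
    then show "P_linear ((act \<phi> \<circ> act \<psi>) - (act \<psi> \<circ> act \<phi>))"
      by (simp add: fun_diff_def)
    have leibniz: "act \<theta> (f * g) = act \<theta> f * g + f * act \<theta> g" for \<theta> f g
      using derivation_act unfolding derivation_def by blast
    have add: "act \<theta> (f + g) = act \<theta> f + act \<theta> g" for \<theta> f g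
      by (rule P_linear_add[OF P_linear_act])
    show "((act \<phi> \<circ> act \<psi>) - (act \<psi> \<circ> act \<phi>)) (f * g) =
        ((act \<phi> \<circ> act \<psi>) - (act \<psi> \<circ> act \<phi>)) f * g + f * ((act \<phi> \<circ> act \<psi>) - (act \<psi> \<circ> act \<phi>)) g" for f g
      by (simp add: fun_diff_def leibniz add) (simp add: algebra_simps)
  qed
next
  fix b
  have *: "act \<phi> (act \<psi> (pvar b)) = (\<Sum>a\<in>UNIV. pscale ((\<phi> ** \<psi>) $ a $ b) (pvar a))" for \<phi> \<psi>
  proof -
    have "act \<phi> (act \<psi> (pvar b)) = (\<Sum>c\<in>UNIV. act \<phi> (pscale (\<psi> $ c $ b) (pvar c)))"
      unfolding act_pvar
      by (rule module_hom.sum) (use P_linear_act in \<open>simp add: linear_iff_module_hom\<close>)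
    also have "\<dots> = (\<Sum>c\<in>UNIV. \<Sum>a\<in>UNIV. pscale (\<phi> $ a $ c * \<psi> $ c $ b) (pvar a))"
      by (simp add: P_linear_scale[OF P_linear_act] act_pvar poly4.scale_sum_right mult.commute)
    also have "\<dots> = (\<Sum>a\<in>UNIV. \<Sum>c\<in>UNIV. pscale (\<phi> $ a $ c * \<psi> $ c $ b) (pvar a))"
      by (rule sum.swap)
    finally show ?thesis by (simp add: matrix_matrix_mult_def poly4.scale_sum_left)
  qed
  show "act (\<phi> ** \<psi> - \<psi> ** \<phi>) (pvar b) = ((act \<phi> \<circ> act \<psi>) - (act \<psi> \<circ> act \<phi>)) (pvar b)"
    by (simp add: fun_diff_def *)
      (simp add: act_pvar poly4.scale_left_diff_distrib sum_subtractf)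
qed

lemma A_in_sl4: "A2 \<in> sl4" "A3 \<in> sl4" "A2s \<in> sl4" "A3s \<in> sl4"
  by (simp_all add: sl4_def trace_def sum_4 A2_def A3_def A2s_def A3s_def mat_unit_def diag4_def)

theorem Omega_unique:
  "T = Omega \<longleftrightarrow> P_linear T \<and> (\<forall>N f. homogeneous N f \<longrightarrow> T f = pscale (of_nat N) f)"
proof -
  have hom: "Omega f = pscale (of_nat N) f" if "homogeneous N f" for N f
  proof -
    have "Omega f = (\<Sum>m\<in>Poly_Mapping.keys f.
        pscale (of_nat N) (Poly_Mapping.single m (Poly_Mapping.lookup f m)))"
      using that by (simp add: Omega_def lin_ext_def pscale_single homogeneous_def mult.commute)
    also have "\<dots> = pscale (of_nat N) f"
      by (subst poly4_expand[of f]) (simp add: poly4.scale_sum_right)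
    finally show ?thesis .
  qed
  have "T = Omega" if "P_linear T" "\<forall>N f. homogeneous N f \<longrightarrow> T f = pscale (of_nat N) f"
  proof
    fix f
    show "T f = Omega f"
    proof (rule P_linear_eqI[OF that(1) P_linear_Omega])
      fix m :: "4 \<Rightarrow>\<^sub>0 nat"
      have "homogeneous (tdeg m) (Poly_Mapping.single m 1)" by (simp add: homogeneous_def)
      then show "T (Poly_Mapping.single m 1) = Omega (Poly_Mapping.single m 1)"
        using that(2) hom by simp
    qed
  qed
  then show ?thesis using hom P_linear_Omega by auto
qed

definition alg_hom :: "(poly4 \<Rightarrow> poly4) \<Rightarrow> bool" where
  "alg_hom T \<longleftrightarrow> P_linear T \<and> T 1 = 1 \<and> (\<forall>f g. T (f * g) = T f * T g)"

lemma psubst_single: "psubst s (Poly_Mapping.single m c) =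
    pscale c (\<Prod>i\<in>UNIV. s i ^ Poly_Mapping.lookup m i)"
  by (simp add: psubst_def lin_ext_single)

lemma psubst_pvar_mult: "psubst s (pvar a * f) = s a * psubst s f"
proof (rule P_linear_eqI[of "\<lambda>f. psubst s (pvar a * f)" "\<lambda>f. s a * psubst s f"])
  show "P_linear (\<lambda>f. psubst s (pvar a * f))"
    by (intro P_linear_comp[OF P_linear_psubst] P_linear_mult P_linear_id)
  show "P_linear (\<lambda>f. s a * psubst s f)" by (intro P_linear_mult P_linear_psubst)
next
  fix m :: "4 \<Rightarrow>\<^sub>0 nat"
  have "(\<Prod>i\<in>UNIV. s i ^ Poly_Mapping.lookup (Poly_Mapping.single a 1) i) =
      (\<Prod>i\<in>UNIV. if i = a then s i else 1)"
    by (rule prod.cong) (auto simp: lookup_single when_def)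
  then show "psubst s (pvar a * Poly_Mapping.single m 1) = s a * psubst s (Poly_Mapping.single m 1)"
    by (simp add: pvar_def mult_single psubst_single lookup_add power_add prod.distrib)
qed

lemma psubst_one: "psubst s 1 = 1"
  using psubst_single[of s 0 1] by simp

lemma psubst_pvar: "psubst s (pvar a) = s a"
  using psubst_pvar_mult[of s a 1] by (simp add: psubst_one)

lemma alg_hom_psubst: "alg_hom (psubst s)"
  unfolding alg_hom_def
proof (intro conjI allI P_linear_psubst psubst_one)
  fix f g
  show "psubst s (f * g) = psubst s f * psubst s g"
  proof (induction f rule: poly4_induct)
    case (const c)
    have "psubst s (pscale c g) = pscale c (psubst s g)"
      by (rule P_linear_scale[OF P_linear_psubst])
    then show ?case by (simp add: psubst_single pscale_def)
  next
    case (add f h)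
    then show ?case by (simp add: P_linear_add[OF P_linear_psubst] algebra_simps)
  next
    case (var a f)
    then show ?case by (simp add: psubst_pvar_mult mult.assoc)
  qed
qed

lemma alg_hom_eqI:
  assumes T: "alg_hom T" and U: "alg_hom U" and eq: "\<And>b. T (pvar b) = U (pvar b)"
  shows "T = U"
proof
  fix f
  show "T f = U f"
  proof (induction f rule: poly4_induct)
    case (const c)
    have "Poly_Mapping.single 0 c = pscale c 1" by (simp add: pscale_def)
    then show ?case using T U by (simp add: alg_hom_def P_linear_scale)
  next
    case (add f g) then show ?case using T U by (simp add: alg_hom_def P_linear_add)
  next
    case (var b f) then show ?case using T U eq by (simp add: alg_hom_def)
  qed
qed

lemma sigma_sigma: "sigma_aut (sigma_aut f) = f"
proof -
  have "(\<lambda>f. sigma_aut (sigma_aut f)) = (\<lambda>f. f)"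
  proof (rule alg_hom_eqI)
    show "alg_hom (\<lambda>f. sigma_aut (sigma_aut f))"
      using alg_hom_psubst[of sigma_img] P_linear_comp[OF P_linear_psubst P_linear_psubst]
      by (simp add: alg_hom_def sigma_aut_def)
    show "alg_hom (\<lambda>f. f)" by (simp add: alg_hom_def P_linear_id)
  next
    fix b :: 4
    have lin: "sigma_aut (f + g) = sigma_aut f + sigma_aut g" "sigma_aut (f - g) = sigma_aut f - sigma_aut g"
      "sigma_aut (pscale c f) = pscale c (sigma_aut f)" for f g c
      using P_linear_psubst[of sigma_img]
      by (simp_all add: sigma_aut_def P_linear_add P_linear_scale linear_iff_module_hom module_hom.diff)
    have four: "4 * f = pscale 4 f" for f :: poly4
      by (simp add: pscale_def)
    have img: "sigma_aut (pvar i) = sigma_img i" for i by (simp add: sigma_aut_def psubst_pvar)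
    have "b = 1 \<or> b = 2 \<or> b = 3 \<or> b = 4" by (rule exhaust_4)
    then show "sigma_aut (sigma_aut (pvar b)) = pvar b"
      by (elim disjE)
        (simp_all add: img sigma_img_def lin,
          simp_all flip: poly4.scale_right_distrib poly4.scale_right_diff_distrib
            add: four)
  qed
  then show ?thesis by metis
qed

theorem sigma_unique:
  "T = sigma_aut \<longleftrightarrow> alg_hom T \<and>
     T px = pscale (1/2) (px + py + pz + pw) \<and> T py = pscale (1/2) (px + py - pz - pw) \<and>
     T pz = pscale (1/2) (px - py + pz - pw) \<and> T pw = pscale (1/2) (px - py - pz + pw)"
  (is "_ \<longleftrightarrow> ?R T")
proof
  have R: "?R sigma_aut"
    unfolding sigma_aut_def using alg_hom_psubst[of sigma_img]
    by (simp only: psubst_pvar) (simp add: sigma_img_def)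
  then show "T = sigma_aut \<Longrightarrow> ?R T" by simp
  assume T: "?R T"
  show "T = sigma_aut"
  proof (rule alg_hom_eqI)
    show "alg_hom T" "alg_hom sigma_aut" using T R by blast+
    fix b :: 4
    have "b = 1 \<or> b = 2 \<or> b = 3 \<or> b = 4" by (rule exhaust_4)
    then show "T (pvar b) = sigma_aut (pvar b)" using T R by (elim disjE) (simp_all only:)
  qed
qed

theorem bij_sigma_aut: "bij sigma_aut"
  by (rule o_bij[of sigma_aut]) (auto simp: sigma_sigma)

end

theory Submission
  imports Defs
begin

text \<open>
  The operators \<open>L\<^sub>1\<close>, \<open>R\<^sub>1\<close> and \<open>\<Omega> + 2I = [L\<^sub>1, R\<^sub>1]\<close> span a copy of \<open>sl\<^sub>2\<close>, and \<open>2C\<^sub>1\<close> is its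
  Casimir element \<open>\<Omega>\<^sup>2 + 2\<Omega> - 4R\<^sub>1L\<^sub>1\<close>. The derivations \<open>A\<^sub>i\<close>, \<open>A\<^sub>i\<^sup>*\<close> annihilate the quadratic form
  \<open>xy - zw\<close> and \<open>\<sigma>\<close> fixes it, so all of them commute with \<open>R\<^sub>1\<close>, with the dual operator \<open>L\<^sub>1\<close>, and
  with everything these two generate.
  The two other expressions for \<open>C\<^sub>1\<close> are compared with this one in normal form in the Weyl algebra.
\<close>

section \<open>Calculus in the Weyl algebra\<close>

lemma pscale_numeral: "pscale (numeral n) f = numeral n * f"
  by (simp add: pscale_def)

lemma P_linear_diff: "P_linear T \<Longrightarrow> T (f - g) = T f - T g"
  using P_linear_add[of T "f - g" g] by (simp add: algebra_simps)

lemma P_linear_numeral_mult: "P_linear T \<Longrightarrow> T (numeral n * f) = numeral n * T f"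
  using P_linear_scale[of T "numeral n" f] by (simp add: pscale_numeral)

lemma P_linear_zero: "P_linear T \<Longrightarrow> T 0 = 0"
  using P_linear_add[of T 0 0] by simp

lemmas P_linear_rules = P_linear_add P_linear_diff P_linear_numeral_mult P_linear_zero

lemmas pderiv4_linear = P_linear_rules[OF P_linear_pderiv4]

lemma pderiv4_mult: "pderiv4 b (f * g) = pderiv4 b f * g + f * pderiv4 b g"
  using derivation_pderiv4 by (simp add: derivation_def)

lemma pderiv4_pscale: "pderiv4 b (pscale c f) = pscale c (pderiv4 b f)"
  by (rule P_linear_scale[OF P_linear_pderiv4])

lemma pderiv4_1: "pderiv4 b 1 = 0"
  and pderiv4_numeral: "pderiv4 b (numeral n) = 0"
  using pderiv4_const[of b 1] pderiv4_const[of b "numeral n"] by simp_all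

lemma pderiv4_commute: "pderiv4 a (pderiv4 b f) = pderiv4 b (pderiv4 a f)"
proof (induction f rule: poly4_induct)
  case (const c)
  then show ?case by (simp add: pderiv4_const pderiv4_linear)
next
  case (add f g)
  then show ?case by (simp add: pderiv4_linear)
next
  case (var c f)
  then show ?case by (simp add: pderiv4_pvar_mult pderiv4_linear)
qed

text \<open>Leibniz moves derivatives inward past the variables, and the permutative
  \<open>pderiv4_commute\<close> sorts mixed partials by ordered rewriting. Operator identities thus
  become ring identities in the partials of \<open>f\<close>.\<close>

lemmas weyl_simps =
  pderiv4_linear pderiv4_mult pderiv4_pvar pderiv4_1 pderiv4_numeral pderiv4_commute

lemma act_A2: "act A2 f = px * pderiv4 3 f + pz * pderiv4 1 f + py * pderiv4 4 f + pw * pderiv4 2 f"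
  and act_A3: "act A3 f = px * pderiv4 4 f + pw * pderiv4 1 f + py * pderiv4 3 f + pz * pderiv4 2 f"
  and act_A2s: "act A2s f = px * pderiv4 1 f - py * pderiv4 2 f + pz * pderiv4 3 f - pw * pderiv4 4 f"
  and act_A3s: "act A3s f = px * pderiv4 1 f - py * pderiv4 2 f - pz * pderiv4 3 f + pw * pderiv4 4 f"
  by (simp_all add: act_def sum_4 A2_def A3_def A2s_def A3s_def mat_unit_def diag4_def)

text \<open>On a monomial, \<open>pvar b * pderiv4 b\<close> multiplies by the exponent of that
  variable, and the exponents add up to the degree.\<close>

lemma Omega_euler:
  "Omega f = px * pderiv4 1 f + py * pderiv4 2 f + pz * pderiv4 3 f + pw * pderiv4 4 f"
proof -
  have "Omega f = (\<Sum>b\<in>UNIV. pvar b * pderiv4 b f)"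
  proof (rule P_linear_eqI[OF P_linear_Omega])
    show "P_linear (\<lambda>f. \<Sum>b\<in>UNIV. pvar b * pderiv4 b f)"
      by (intro P_linear_sum P_linear_mult P_linear_pderiv4)
    fix m :: "4 \<Rightarrow>\<^sub>0 nat"
    have "pvar b * pderiv4 b (Poly_Mapping.single m 1)
        = Poly_Mapping.single m (of_nat (Poly_Mapping.lookup m b))" for b
    proof (cases "Poly_Mapping.lookup m b = 0")
      \<comment> \<open>A nonzero exponent makes the truncated subtraction of exponents
        exact.\<close>
      case False
      then have "Poly_Mapping.single b 1 + (m - Poly_Mapping.single b 1) = m"
        by (intro poly_mapping_eqI) (auto simp: lookup_add lookup_minus lookup_single when_def)
      then show ?thesis by (simp add: pvar_def pderiv4_single mult_single)
    qed (simp add: pderiv4_single)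
    moreover have "(\<Sum>b\<in>S. Poly_Mapping.single m (of_nat (Poly_Mapping.lookup m b)))
        = Poly_Mapping.single m (of_nat (\<Sum>b\<in>S. Poly_Mapping.lookup m b) :: complex)" for S :: "4 set"
      by (induction S rule: infinite_finite_induct) (simp_all add: single_add)
    ultimately show "Omega (Poly_Mapping.single m 1)
        = (\<Sum>b\<in>UNIV. pvar b * pderiv4 b (Poly_Mapping.single m 1))"
      by (simp add: Omega_def lin_ext_single tdeg_def)
  qed
  then show ?thesis by (simp add: sum_4)
qed

section \<open>The Casimir element\<close>

lemma L1_R1: "L1 (R1 f) = R1 (L1 f) + Omega f + 2 * f"
  by (simp add: L1_def R1_def Omega_euler algebra_simps weyl_simps)

lemma Omega_R1: "Omega (R1 f) = R1 (Omega f) + 2 * R1 f"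
  by (simp add: R1_def Omega_euler algebra_simps weyl_simps)

lemma Omega_L1: "Omega (L1 f) = L1 (Omega f) - 2 * L1 f"
  by (simp add: L1_def Omega_euler algebra_simps weyl_simps)

text \<open>A commutator of derivations is a derivation, so second-order terms cancel. Squaring this
  collapsed form yields order two instead of four.\<close>

lemma bracket_A2_A3s: "act A2 (act A3s f) - act A3s (act A2 f)
    = 2 * (pz * pderiv4 1 f - px * pderiv4 3 f + py * pderiv4 4 f - pw * pderiv4 2 f)"
  by (simp add: act_A2 act_A3s algebra_simps weyl_simps)

lemma bracket_A2s_A3: "act A2s (act A3 f) - act A3 (act A2s f)
    = 2 * (px * pderiv4 4 f - pw * pderiv4 1 f + pz * pderiv4 2 f - py * pderiv4 3 f)"
  by (simp add: act_A2s act_A3 algebra_simps weyl_simps)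

text \<open>Normal order: \<open>L1_R1\<close> turns (Omega + 2I)^2 - 2(L1 R1 + R1 L1) into this,
  the constants cancelling.\<close>

definition casimir :: "poly4 \<Rightarrow> poly4"
  where "casimir f = Omega (Omega f) + 2 * Omega f - 4 * R1 (L1 f)"

text \<open>\<open>A2\<close>, \<open>A3s\<close> and their bracket span one of the two commuting
  sl2 factors of the so4 preserving xy - zw; the left side is four times its Casimir
  element.\<close>

lemma casimir_A2_A3s:
  "4 * act A2 (act A2 f) + 4 * act A3s (act A3s f)
    - (let B = \<lambda>f. act A2 (act A3s f) - act A3s (act A2 f) in B (B f)) = 4 * casimir f"
  unfolding Let_def bracket_A2_A3s
  by (simp add: casimir_def Omega_euler R1_def L1_def act_A2 act_A3s weyl_simps)
    (simp add: algebra_simps)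

text \<open>The same for the other sl2 factor.\<close>

lemma casimir_A2s_A3:
  "4 * act A2s (act A2s f) + 4 * act A3 (act A3 f)
    - (let B = \<lambda>f. act A2s (act A3 f) - act A3 (act A2s f) in B (B f)) = 4 * casimir f"
  unfolding Let_def bracket_A2s_A3
  by (simp add: casimir_def Omega_euler R1_def L1_def act_A2s act_A3 weyl_simps)
    (simp add: algebra_simps)

lemma act_commutes:
  assumes "A \<in> {A2, A3, A2s, A3s}"
  shows "act A (R1 f) = R1 (act A f)"
    "act A (L1 f) = L1 (act A f)"
  using assms
  by (auto simp: R1_def L1_def act_A2 act_A3 act_A2s act_A3s weyl_simps algebra_simps)

section \<open>Sigma and differentiation\<close>

lemma P_linear_sigma_aut: "P_linear sigma_aut"
  unfolding sigma_aut_def by (rule P_linear_psubst)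

lemmas sigma_aut_linear = P_linear_rules[OF P_linear_sigma_aut]

lemma sigma_aut_mult: "sigma_aut (f * g) = sigma_aut f * sigma_aut g"
  using alg_hom_psubst by (simp add: sigma_aut_def alg_hom_def)

lemma sigma_aut_pvar: "sigma_aut (pvar a) = sigma_img a"
  by (simp add: sigma_aut_def psubst_pvar)

text \<open>The chain rule for the linear substitution sigma.\<close>

lemma pderiv4_sigma_aut: "pderiv4 b (sigma_aut f) =
    (\<Sum>a\<in>UNIV. pderiv4 b (sigma_img a) * sigma_aut (pderiv4 a f))"
proof (induction f rule: poly4_induct)
  case (const c)
  have "sigma_aut (Poly_Mapping.single 0 c) = Poly_Mapping.single 0 c"
    by (simp add: sigma_aut_def psubst_single pscale_def)
  then show ?case
    by (simp add: pderiv4_const sigma_aut_linear)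
next
  case (add f g)
  then show ?case
    by (simp add: sigma_aut_linear pderiv4_linear distrib_left sum.distrib)
next
  case (var c f)
  \<comment> \<open>The extra term at \<open>a = c\<close> supplies the Leibniz term in which
    \<open>pderiv4 b\<close> hits \<open>sigma_img c\<close>.\<close>
  have "pderiv4 b (sigma_img a) * sigma_aut (pderiv4 a (pvar c * f)) =
      (if a = c then pderiv4 b (sigma_img c) * sigma_aut f else 0)
      + sigma_img c * (pderiv4 b (sigma_img a) * sigma_aut (pderiv4 a f))" for a
    by (simp add: pderiv4_pvar_mult sigma_aut_linear sigma_aut_mult sigma_aut_pvar)
      (simp add: algebra_simps)
  then show ?case using var
    by (simp add: pderiv4_mult sum.distrib sum_distrib_left sigma_aut_mult sigma_aut_pvar)
qed

text \<open>The matrix of sigma is symmetric, so the partials transform with the same signs as the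
  variables.\<close>

lemma sigma_aut_pderiv4:
  "pderiv4 1 (sigma_aut f) = pscale (1/2) (sigma_aut (pderiv4 1 f + pderiv4 2 f + pderiv4 3 f + pderiv4 4 f))"
  "pderiv4 2 (sigma_aut f) = pscale (1/2) (sigma_aut (pderiv4 1 f + pderiv4 2 f - pderiv4 3 f - pderiv4 4 f))"
  "pderiv4 3 (sigma_aut f) = pscale (1/2) (sigma_aut (pderiv4 1 f - pderiv4 2 f + pderiv4 3 f - pderiv4 4 f))"
  "pderiv4 4 (sigma_aut f) = pscale (1/2) (sigma_aut (pderiv4 1 f - pderiv4 2 f - pderiv4 3 f + pderiv4 4 f))"
  by (simp_all add: pderiv4_sigma_aut sum_4 sigma_img_def weyl_simps pderiv4_pscale pscale_mult_left
      sigma_aut_linear poly4.scale_right_distrib poly4.scale_right_diff_distrib)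

lemma sigma_aut_L1: "sigma_aut (L1 f) = L1 (sigma_aut f)"
proof -
  have "L1 (sigma_aut f) = pscale (1/4) (4 * sigma_aut (L1 f))"
    by (simp add: L1_def sigma_aut_pderiv4 pderiv4_pscale poly4.scale_right_diff_distrib[symmetric])
      (simp add: weyl_simps sigma_aut_linear)
  also have "\<dots> = sigma_aut (L1 f)"
    by (simp flip: pscale_numeral)
  finally show ?thesis ..
qed

lemma sigma_aut_R1: "sigma_aut (R1 f) = R1 (sigma_aut f)"
proof -
  \<comment> \<open>Differences of squares: (x+y)^2 - (z+w)^2 - (x-y)^2 + (z-w)^2 = 4(xy - zw). The
    two halves combine to 1/4.\<close>
  have "sigma_img 1 * sigma_img 2 - sigma_img 3 * sigma_img 4 = pscale (1/4) (4 * (px * py - pz * pw))"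
    by (simp add: sigma_img_def pscale_mult_left pscale_mult_right poly4.scale_right_diff_distrib[symmetric])
      (simp add: algebra_simps)
  also have "\<dots> = px * py - pz * pw"
    by (simp flip: pscale_numeral)
  finally show ?thesis
    by (simp add: R1_def sigma_aut_mult sigma_aut_linear sigma_aut_pvar)
qed

section \<open>Centrality of the Casimir element\<close>

lemma P_linear_L1: "P_linear L1"
  unfolding L1_def[abs_def] by (intro P_linear_minus P_linear_comp[OF P_linear_pderiv4] P_linear_pderiv4)

lemma P_linear_R1: "P_linear R1"
  unfolding R1_def[abs_def] by (intro P_linear_mult P_linear_id)

text \<open>Since \<open>\<Omega>\<close> is determined by \<open>[L\<^sub>1, R\<^sub>1] = \<Omega> + 2I\<close>, it needs no hypothesis of its own here.\<close>

lemma casimir_commutes: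
  assumes T: "P_linear T" and L: "\<And>f. T (L1 f) = L1 (T f)" and R: "\<And>f. T (R1 f) = R1 (T f)"
  shows "casimir (T f) = T (casimir f)"
proof -
  have "Omega f = L1 (R1 f) - R1 (L1 f) - 2 * f" for f
    by (simp add: L1_R1)
  then have "T (Omega f) = Omega (T f)" for f
    by (simp add: P_linear_rules[OF T] L R)
  then show ?thesis
    by (simp add: casimir_def P_linear_rules[OF T] L R)
qed

text \<open>\<open>L1\<close> and \<open>R1\<close> do not commute with each other, so
  \<open>casimir_commutes\<close> cannot apply; the three sl2 relations give centrality
  directly.\<close>

lemma casimir_commutes_sl2:
  "casimir (Omega f) = Omega (casimir f)"
  "casimir (L1 f) = L1 (casimir f)"
  "casimir (R1 f) = R1 (casimir f)"
  by (simp_all add: casimir_def L1_R1 Omega_R1 Omega_L1 P_linear_rules[OF P_linear_L1]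
      P_linear_rules[OF P_linear_R1] P_linear_rules[OF P_linear_Omega])

theorem proposition13p7:
  shows "let C1 = (1/2) *\<^sub>o ((Omega + 2 *\<^sub>o id) ^^ 2) - (L1 \<circ> R1) - (R1 \<circ> L1) in
     C1 = (1/8) *\<^sub>o (4 *\<^sub>o (act A2 ^^ 2) + 4 *\<^sub>o (act A3s ^^ 2)
                    - ((act A2 \<circ> act A3s) - (act A3s \<circ> act A2)) ^^ 2)
   \<and> C1 = (1/8) *\<^sub>o (4 *\<^sub>o (act A2s ^^ 2) + 4 *\<^sub>o (act A3 ^^ 2)
                    - ((act A2s \<circ> act A3) - (act A3 \<circ> act A2s)) ^^ 2)
   \<and> (\<forall>T \<in> {Omega, L1, R1, act A2, act A2s, act A3, act A3s, sigma_aut}. C1 \<circ> T = T \<circ> C1)"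
proof -
  define C1 where "C1 = (1/2) *\<^sub>o casimir"
  have "(1/2) *\<^sub>o ((Omega + 2 *\<^sub>o id) ^^ 2) - (L1 \<circ> R1) - (R1 \<circ> L1) = C1"
  proof
    fix f
    \<comment> \<open>All terms go under the factor 1/2, leaving integer coefficients to
      compare.\<close>
    have "pscale (1/2) (Omega (Omega f) + 2 * Omega f + 2 * (Omega f + 2 * f)) - L1 (R1 f) - R1 (L1 f)
      = pscale (1/2) (Omega (Omega f) + 2 * Omega f + 2 * (Omega f + 2 * f)
          - 2 * L1 (R1 f) - 2 * R1 (L1 f))"
      by (simp add: poly4.scale_right_diff_distrib flip: pscale_numeral)
    also have "\<dots> = pscale (1/2) (casimir f)"
      by (simp add: casimir_def L1_R1 algebra_simps)
    finally show "((1/2) *\<^sub>o ((Omega + 2 *\<^sub>o id) ^^ 2) - (L1 \<circ> R1) - (R1 \<circ> L1)) f = C1 f"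
      by (simp add: C1_def op_scale_def numeral_2_eq_2 pscale_numeral P_linear_rules[OF P_linear_Omega])
  qed
  moreover have eighth: "pscale (1/8) (4 * f) = pscale (1/2) f" for f
    by (simp flip: pscale_numeral)
  have "(1/8) *\<^sub>o (4 *\<^sub>o (act A2 ^^ 2) + 4 *\<^sub>o (act A3s ^^ 2)
      - ((act A2 \<circ> act A3s) - (act A3s \<circ> act A2)) ^^ 2) = C1"
    using casimir_A2_A3s eighth
    by (simp add: fun_eq_iff C1_def op_scale_def numeral_2_eq_2 pscale_numeral Let_def)
  moreover have "(1/8) *\<^sub>o (4 *\<^sub>o (act A2s ^^ 2) + 4 *\<^sub>o (act A3 ^^ 2)
      - ((act A2s \<circ> act A3) - (act A3 \<circ> act A2s)) ^^ 2) = C1"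
    using casimir_A2s_A3 eighth
    by (simp add: fun_eq_iff C1_def op_scale_def numeral_2_eq_2 pscale_numeral Let_def)
  moreover have "C1 \<circ> T = T \<circ> C1"
    if "T \<in> {Omega, L1, R1, act A2, act A2s, act A3, act A3s, sigma_aut}" for T
  proof -
    have "P_linear T"
      using that P_linear_Omega P_linear_L1 P_linear_R1 P_linear_act P_linear_sigma_aut
      by auto
    moreover have "casimir (T f) = T (casimir f)" for f
    \<comment> \<open>The sl2 generators use centrality; the other operators commute with both
      \<open>L1\<close> and \<open>R1\<close>.\<close>
    proof (cases "T \<in> {Omega, L1, R1}")
      case True
      then show ?thesis using casimir_commutes_sl2 by auto
    next
      case False
      then show ?thesis using that act_commutes sigma_aut_L1 sigma_aut_R1
        by (intro casimir_commutes \<open>P_linear T\<close>) auto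
    qed
    ultimately show ?thesis
      by (auto simp: C1_def op_scale_def P_linear_scale)
  qed
  ultimately show ?thesis
    by (simp add: Let_def)
qed

end
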